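(* Let $G$ be a finite group, let $H \subseteq K$ be subgroups of $G$, and let $p$ be the smallest prime dividing $|\operatorname{Aut}(K)|$. Let $X_H=\{x\in H : C_{\operatorname{Aut}(K)}(x)=\{I\}\}$, where $I$ is the identity element of $\operatorname{Aut}(K)$. Then $$\Pr(H,\operatorname{Aut}(K)) \geq \frac{|L(H,\operatorname{Aut}(K))|}{|H|} + \frac{p\,(|H|-|X_H|-|L(H,\operatorname{Aut}(K))|)+|X_H|}{|H||\operatorname{Aut}(K)|}$$ and $$\Pr(H,\operatorname{Aut}(K)) \leq \frac{(p-1)|L(H,\operatorname{Aut}(K))|+|H|}{p|H|} - \frac{|X_H|(|\operatorname{Aut}(K)|-p)}{p|H||\operatorname{Aut}(K)|}.$$
   Context: For $x\in K$ and $\alpha\in\operatorname{Aut}(K)$ (the automorphism group of $K$), the autocommutator is $[x,\alpha]=x^{-1}\alpha(x)$. $\Pr(H,\operatorname{Aut}(K)) = \frac{|\{(x,\alpha)\in H\times \operatorname{Aut}(K) : [x,\alpha]=1\}|}{|H||\operatorname{Aut}(K)|}$. $C_{\operatorname{Aut}(K)}(x)=\{\alpha\in\operatorname{Aut}(K):\alpha(x)=x\}$ and $L(H,\operatorname{Aut}(K))=\{x\in H : [x,\alpha]=1 \text{ for all } \alpha\in\operatorname{Aut}(K)\}$, a subgroup of $H$. *)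

theory Defs
  imports Complex_Main "HOL-Algebra.Bij" "HOL-Algebra.Coset" "HOL-Computational_Algebra.Primes"
begin

text \<open>
  Throughout, the structure argument \<open>K\<close> is a group in its own right, and \<open>H\<close> is a subset of its
  carrier. The automorphism group of \<open>K\<close> is \<^const>\<open>AutoGroup\<close>; its elements are extensional
  functions on \<open>carrier K\<close>, so they are in bijection with the automorphisms of \<open>K\<close>.
\<close>

definition autocommutator :: "('a, 'b) monoid_scheme \<Rightarrow> 'a \<Rightarrow> ('a \<Rightarrow> 'a) \<Rightarrow> 'a" where
  "autocommutator K x \<alpha> = inv\<^bsub>K\<^esub> x \<otimes>\<^bsub>K\<^esub> \<alpha> x"

definition autocomm_prob :: "'a set \<Rightarrow> ('a, 'b) monoid_scheme \<Rightarrow> real" where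
  "autocomm_prob H K =
     real (card {(x, \<alpha>) \<in> H \<times> carrier (AutoGroup K). autocommutator K x \<alpha> = \<one>\<^bsub>K\<^esub>})
     / (real (card H) * real (order (AutoGroup K)))"

definition aut_centralizer :: "('a, 'b) monoid_scheme \<Rightarrow> 'a \<Rightarrow> ('a \<Rightarrow> 'a) set" where
  "aut_centralizer K x = {\<alpha> \<in> carrier (AutoGroup K). \<alpha> x = x}"

definition autocomm_center :: "'a set \<Rightarrow> ('a, 'b) monoid_scheme \<Rightarrow> 'a set" where
  "autocomm_center H K =
     {x \<in> H. \<forall>\<alpha> \<in> carrier (AutoGroup K). autocommutator K x \<alpha> = \<one>\<^bsub>K\<^esub>}"

definition trivial_aut_centralizer_set :: "'a set \<Rightarrow> ('a, 'b) monoid_scheme \<Rightarrow> 'a set" where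
  "trivial_aut_centralizer_set H K =
     {x \<in> H. aut_centralizer K x = {\<one>\<^bsub>AutoGroup K\<^esub>}}"

end

theory Submission
  imports Defs
begin

text \<open>
  Counting pairs by their first component, the numerator of the probability is the sum over
  \<open>x \<in> H\<close> of the orders of the stabilisers \<open>C(x)\<close>. Such an order is \<open>|Aut K|\<close> on the
  autocentre, \<open>1\<close> on \<open>X\<^sub>H\<close>, and elsewhere that of a proper nontrivial subgroup, so both it and its
  index are at least \<open>p\<close>.
\<close>

text \<open>Any prime factor of \<open>d\<close> also divides \<open>n\<close>, hence is at least
  \<open>p\<close>, and it cannot exceed \<open>d\<close>. This serves twice below: for the order
  and for the index of a stabiliser.\<close>

lemma divisor_ge_least_prime:
  fixes p d n :: nat
  assumes "d dvd n" "d \<noteq> 1" and "\<And>q. prime q \<Longrightarrow> q dvd n \<Longrightarrow> p \<le> q" "n > 0"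
  shows "p \<le> d"
proof -
  obtain q where q: "prime q" "q dvd d"
    using prime_factor_nat[OF assms(2)] by blast
  then have "p \<le> q"
    using assms(1,3) dvd_trans by blast
  also have "q \<le> d"
    using q(2) assms(1,4) by (metis dvd_imp_le dvd_pos_nat)
  finally show ?thesis .
qed

lemma finite_carrier_AutoGroup:
  assumes "finite (carrier K)"
  shows "finite (carrier (AutoGroup K))"
proof (rule finite_subset)
  \<comment> \<open>Automorphisms are represented as \<open>undefined\<close> off
    \<open>carrier K\<close>, which places them in the extensional function space, a finite
    set.\<close>
  show "carrier (AutoGroup K) \<subseteq> carrier K \<rightarrow>\<^sub>E carrier K"
    by (auto simp: AutoGroup_def auto_def Bij_def PiE_def bij_betw_def)
  show "finite (carrier K \<rightarrow>\<^sub>E carrier K)"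
    using assms by (simp add: finite_PiE)
qed

lemma autocommutator_eq_one_iff:
  assumes "group K" "x \<in> carrier K" "\<alpha> \<in> carrier (AutoGroup K)"
  shows "autocommutator K x \<alpha> = \<one>\<^bsub>K\<^esub> \<longleftrightarrow> \<alpha> x = x"
proof -
  interpret group K by fact
  have "\<alpha> x \<in> carrier K"
    using assms(2,3) by (auto simp: AutoGroup_def auto_def Bij_def bij_betw_def)
  then show ?thesis
    using assms(2) unfolding autocommutator_def
    by (metis inv_closed inv_equality inv_inv l_inv)
qed

lemma aut_centralizer_subgroup:
  assumes "group K" "x \<in> carrier K"
  shows "subgroup (aut_centralizer K x) (AutoGroup K)"
proof -
  interpret Aut: group "AutoGroup K"
    using assms(1) by (rule group.AutoGroup)
  \<comment> \<open>The product in \<open>BijGroup\<close> is composition cut off outside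
    \<open>carrier K\<close>; at a point of the carrier it agrees with plain composition.\<close>
  have mult: "(\<alpha> \<otimes>\<^bsub>AutoGroup K\<^esub> \<beta>) x = \<alpha> (\<beta> x)"
    if "\<alpha> \<in> carrier (AutoGroup K)" "\<beta> \<in> carrier (AutoGroup K)" for \<alpha> \<beta>
    using that assms(2) by (simp add: AutoGroup_def BijGroup_def auto_def compose_def)
  have one: "\<one>\<^bsub>AutoGroup K\<^esub> x = x"
    using assms(2) by (simp add: AutoGroup_def BijGroup_def)
  show ?thesis
  proof (rule Aut.subgroupI)
    show "aut_centralizer K x \<noteq> {}"
      using one by (auto simp: aut_centralizer_def)
  next
    fix \<alpha> assume "\<alpha> \<in> aut_centralizer K x"
    \<comment> \<open>Evaluating inv \<alpha> * \<alpha> = 1 at \<open>x\<close> and using \<alpha>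
      x = x shows that the inverse fixes \<open>x\<close>, without an explicit formula for
      it.\<close>
    then show "inv\<^bsub>AutoGroup K\<^esub> \<alpha> \<in> aut_centralizer K x"
      using mult[of "inv\<^bsub>AutoGroup K\<^esub> \<alpha>" \<alpha>] one by (simp add: aut_centralizer_def)
  next
    fix \<alpha> \<beta> assume "\<alpha> \<in> aut_centralizer K x" "\<beta> \<in> aut_centralizer K x"
    then show "\<alpha> \<otimes>\<^bsub>AutoGroup K\<^esub> \<beta> \<in> aut_centralizer K x"
      using mult by (simp add: aut_centralizer_def)
  qed (auto simp: aut_centralizer_def)
qed

text \<open>Lagrange's theorem factors |Aut K| as index times order of the stabiliser. Nontriviality
  keeps the order away from 1 and properness the index, so the least-prime argument applies to each
  factor.\<close>

lemma card_aut_centralizer_bounds: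
  assumes "group K" "finite (carrier K)" "x \<in> carrier K"
    and "\<And>q. prime q \<Longrightarrow> q dvd order (AutoGroup K) \<Longrightarrow> p \<le> q"
    and "aut_centralizer K x \<noteq> {\<one>\<^bsub>AutoGroup K\<^esub>}"
    and "aut_centralizer K x \<noteq> carrier (AutoGroup K)"
  shows "p \<le> card (aut_centralizer K x)"
    and "p * card (aut_centralizer K x) \<le> order (AutoGroup K)"
proof -
  interpret Aut: group "AutoGroup K"
    using assms(1) by (rule group.AutoGroup)
  let ?C = "aut_centralizer K x"
  have sub: "subgroup ?C (AutoGroup K)"
    using assms(1,3) by (rule aut_centralizer_subgroup)
  have fin: "finite (carrier (AutoGroup K))"
    using assms(2) by (rule finite_carrier_AutoGroup)
  have pos: "order (AutoGroup K) > 0"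
    using fin by (simp add: Aut.order_gt_0_iff_finite)
  have lagrange: "card (rcosets\<^bsub>AutoGroup K\<^esub> ?C) * card ?C = order (AutoGroup K)"
    using sub by (rule Aut.lagrange)
  have "card ?C \<noteq> 1"
    using assms(5) subgroup.one_closed[OF sub] by (auto simp: card_1_singleton_iff)
  then show "p \<le> card ?C"
    using lagrange divisor_ge_least_prime[OF _ _ assms(4) pos] by (metis dvd_triv_right)
  have "card ?C < order (AutoGroup K)"
    unfolding order_def using fin assms(6) sub by (intro psubset_card_mono) (auto dest: subgroup.subset)
  then have "card (rcosets\<^bsub>AutoGroup K\<^esub> ?C) \<noteq> 1"
    using lagrange by auto
  then have "p \<le> card (rcosets\<^bsub>AutoGroup K\<^esub> ?C)"
    using lagrange divisor_ge_least_prime[OF _ _ assms(4) pos] by (metis dvd_triv_left)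
  then show "p * card ?C \<le> order (AutoGroup K)"
    using lagrange by (metis mult_le_mono1)
qed

lemma autocomm_center_eq:
  assumes "group K" "H \<subseteq> carrier K"
  shows "autocomm_center H K = {x \<in> H. aut_centralizer K x = carrier (AutoGroup K)}"
  using assms autocommutator_eq_one_iff[OF assms(1)]
  unfolding autocomm_center_def aut_centralizer_def by blast

lemma autocomm_prob_eq_sum:
  assumes "group K" "finite (carrier K)" "H \<subseteq> carrier K"
  shows "autocomm_prob H K =
    (\<Sum>x\<in>H. real (card (aut_centralizer K x))) / (real (card H) * real (order (AutoGroup K)))"
proof -
  have "{(x, \<alpha>) \<in> H \<times> carrier (AutoGroup K). autocommutator K x \<alpha> = \<one>\<^bsub>K\<^esub>}
      = Sigma H (aut_centralizer K)"
    using autocommutator_eq_one_iff[OF assms(1)] assms(3)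
    by (auto simp: aut_centralizer_def)
  moreover have "card (Sigma H (aut_centralizer K)) = (\<Sum>x\<in>H. card (aut_centralizer K x))"
    using assms(2,3) finite_carrier_AutoGroup[OF assms(2)]
    by (intro card_SigmaI) (auto intro: finite_subset simp: aut_centralizer_def)
  ultimately show ?thesis
    by (simp add: autocomm_prob_def)
qed

text \<open>\<open>S\<close> is the numerator of the probability. The factor
  \<open>h - x - l\<close> counts the elements outside both special sets, each contributing between
  \<open>p\<close> and \<open>A / p\<close>.\<close>

lemma sum_card_aut_centralizer_bounds:
  fixes p :: nat
  assumes "group K" "finite (carrier K)" "H \<subseteq> carrier K" "p > 1"
    and dvd: "p dvd order (AutoGroup K)"
    and least: "\<And>q. prime q \<Longrightarrow> q dvd order (AutoGroup K) \<Longrightarrow> p \<le> q"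
  defines "A \<equiv> real (order (AutoGroup K))"
    and "h \<equiv> real (card H)"
    and "l \<equiv> real (card (autocomm_center H K))"
    and "x \<equiv> real (card (trivial_aut_centralizer_set H K))"
    and "S \<equiv> (\<Sum>y\<in>H. real (card (aut_centralizer K y)))"
  shows "l * A + x + (h - x - l) * p \<le> S" and "S \<le> l * A + x + (h - x - l) * (A / p)"
proof -
  let ?c = "\<lambda>y. real (card (aut_centralizer K y))"
  define L where "L = autocomm_center H K"
  define X where "X = trivial_aut_centralizer_set H K"
  define R where "R = H - L - X"
  have L: "L = {y \<in> H. aut_centralizer K y = carrier (AutoGroup K)}"
    unfolding L_def using assms(1,3) by (rule autocomm_center_eq)
  have X: "X = {y \<in> H. aut_centralizer K y = {\<one>\<^bsub>AutoGroup K\<^esub>}}"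
    by (simp add: X_def trivial_aut_centralizer_set_def)
  have finH: "finite H"
    using assms(2,3) finite_subset by blast
  \<comment> \<open>Since \<open>p > 1\<close> divides |Aut K|, the automorphism group is
    nontrivial. Otherwise \<open>L\<close> and \<open>X\<close> would both be all of
    \<open>H\<close>, and its elements would be counted twice.\<close>
  have "carrier (AutoGroup K) \<noteq> {\<one>\<^bsub>AutoGroup K\<^esub>}"
    using dvd \<open>p > 1\<close> by (auto simp: order_def)
  then have disj: "L \<inter> X = {}"
    by (auto simp: L X)
  have disjR: "(L \<union> X) \<inter> R = {}"
    by (auto simp: R_def)
  have split: "H = L \<union> X \<union> R"
    by (auto simp: R_def L X)
  have fin: "finite L" "finite X" "finite R"
    using finH by (auto simp: R_def L X)
  have "card H = card L + card X + card R"
    using fin disj disjR by (subst split) (simp add: card_Un_disjoint)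
  then have cR: "real (card R) = h - x - l"
    by (simp add: h_def x_def l_def L_def X_def)
  have "S = sum ?c L + sum ?c X + sum ?c R"
    unfolding S_def using fin disj disjR by (subst split) (simp add: sum.union_disjoint)
  moreover have "sum ?c L = l * A"
    \<comment> \<open>\<open>L\<close> is folded first, so that \<open>l\<close> becomes its
      cardinality, and then replaced by its description through stabilisers, which makes every
      summand |Aut K|. The sum over \<open>X\<close> is treated in the same way.\<close>
    by (simp add: l_def A_def order_def flip: L_def) (simp add: L)
  moreover have "sum ?c X = x"
    by (simp add: x_def flip: X_def) (simp add: X)
  ultimately have S: "S = l * A + x + sum ?c R"
    by simp
  \<comment> \<open>Lying outside \<open>L\<close> and \<open>X\<close> says exactly that the
    stabiliser is proper and nontrivial.\<close>
  have bounds: "p \<le> card (aut_centralizer K y)"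
      "p * card (aut_centralizer K y) \<le> order (AutoGroup K)" if "y \<in> R" for y
    using card_aut_centralizer_bounds[OF assms(1,2) _ least, of y] that assms(3)
    by (auto simp: R_def L X)
  have "card R * real p \<le> sum ?c R"
    using bounds(1) by (intro sum_bounded_below) simp
  then show "l * A + x + (h - x - l) * p \<le> S"
    by (simp add: S cR)
  have "?c y \<le> A / p" if "y \<in> R" for y
  proof -
    have "real (p * card (aut_centralizer K y)) \<le> A"
      unfolding A_def using bounds(2)[OF that] of_nat_le_iff by blast
    then show ?thesis
      using \<open>p > 1\<close> by (simp add: field_simps)
  qed
  then have "sum ?c R \<le> card R * (A / p)"
    by (rule sum_bounded_above)
  then show "S \<le> l * A + x + (h - x - l) * (A / p)"
    by (simp add: S cR)
qed

theorem theorem3p7: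
  fixes G :: "('a, 'b) monoid_scheme" and H K :: "'a set" and p :: nat
  assumes "group G"
    and "finite (carrier G)"
    and "subgroup H G"
    and "subgroup K G"
    and "H \<subseteq> K"
    and "prime p"
    and "p dvd order (AutoGroup (G\<lparr>carrier := K\<rparr>))"
    and "\<And>q. prime q \<Longrightarrow> q dvd order (AutoGroup (G\<lparr>carrier := K\<rparr>)) \<Longrightarrow> p \<le> q"
  defines "A \<equiv> real (order (AutoGroup (G\<lparr>carrier := K\<rparr>)))"
    and "h \<equiv> real (card H)"
    and "l \<equiv> real (card (autocomm_center H (G\<lparr>carrier := K\<rparr>)))"
    and "x \<equiv> real (card (trivial_aut_centralizer_set H (G\<lparr>carrier := K\<rparr>)))"
  shows "autocomm_prob H (G\<lparr>carrier := K\<rparr>)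
           \<ge> l / h + (real p * (h - x - l) + x) / (h * A)
       \<and> autocomm_prob H (G\<lparr>carrier := K\<rparr>)
           \<le> ((real p - 1) * l + h) / (real p * h) - x * (A - real p) / (real p * h * A)"
proof -
  let ?K = "G\<lparr>carrier := K\<rparr>"
  let ?S = "\<Sum>y\<in>H. real (card (aut_centralizer ?K y))"
  interpret group G by fact
  have K: "group ?K"
    using assms(4) by (rule subgroup.subgroup_is_group) (rule assms(1))
  have fin: "finite (carrier ?K)"
    using assms(2,4) by (auto dest: subgroup.subset finite_subset)
  have H: "H \<subseteq> carrier ?K"
    using assms(5) by simp
  have p: "p > 1"
    using assms(6) by (rule prime_gt_1_nat)
  interpret Aut: group "AutoGroup ?K"
    using K by (rule group.AutoGroup)
  have A: "A > 0"
    using finite_carrier_AutoGroup[OF fin]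
    by (simp add: A_def Aut.order_gt_0_iff_finite)
  \<comment> \<open>The identity lies in \<open>H\<close>, so \<open>H\<close> is nonempty; with a
    positive denominator \<open>h * A\<close>, inequalities survive the division.\<close>
  have h: "h > 0"
    using subgroup.one_closed[OF assms(3)] finite_subset[OF H fin]
    by (auto simp: h_def card_gt_0_iff)
  have prob: "autocomm_prob H ?K = ?S / (h * A)"
    using autocomm_prob_eq_sum[OF K fin H] by (simp add: h_def A_def)
  have lower: "l * A + x + (h - x - l) * p \<le> ?S"
    and upper: "?S \<le> l * A + x + (h - x - l) * (A / p)"
    using sum_card_aut_centralizer_bounds[OF K fin H p assms(7,8)]
    by (simp_all add: A_def h_def l_def x_def)
  have "l / h + (real p * (h - x - l) + x) / (h * A)
      = (l * A + x + (h - x - l) * p) / (h * A)"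
    using A h by (simp add: field_simps)
  also have "\<dots> \<le> ?S / (h * A)"
    using lower A h by (intro divide_right_mono) auto
  finally have 1: "l / h + (real p * (h - x - l) + x) / (h * A) \<le> autocomm_prob H ?K"
    by (simp add: prob)
  have "?S / (h * A) \<le> (l * A + x + (h - x - l) * (A / p)) / (h * A)"
    using upper A h by (intro divide_right_mono) auto
  \<comment> \<open>Over the common denominator \<open>p * h * A\<close> the numerator is
    \<open>p * l * A + p * x + (h - x - l) * A\<close>, which regroups as
    \<open>((p - 1) * l + h) * A - x * (A - p)\<close>.\<close>
  also have "\<dots> = ((real p - 1) * l + h) / (real p * h) - x * (A - real p) / (real p * h * A)"
    using A h p by (simp add: field_simps)
  finally show ?thesis
    using 1 by (simp add: prob)
qed

end
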